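(* Let $\{p_\theta:\theta\in\Theta\}$ be a regular uniparametric exponential family with natural parameter $\theta$ in an open interval $\Theta\subset\mathbb{R}$ and cumulant function $F(\theta)$ (so that its Fisher information is $F''(\theta)>0$). Let $h_F$ be an antiderivative of $\theta\mapsto\sqrt{F''(\theta)}$ on $\Theta$. Then for all $\theta_0,\theta_1\in\Theta$ the Fisher-Rao distance between $p_{\theta_0}$ and $p_{\theta_1}$ is $$\rho(\theta_0,\theta_1)=\left|h_F(\theta_1)-h_F(\theta_0)\right|.$$
   Context: A uniparametric exponential family has densities $p_\theta(x)=\exp(\theta\, t(x)-F(\theta))$ with respect to a fixed positive measure, where $t(x)$ is the (non-constant) sufficient statistic and $F$ the cumulant (log-normalizer) function. For a regular statistical model with connected open parameter set $\Theta\subset\mathbb{R}^m$, the Fisher metric is the Riemannian metric on $\Theta$ whose matrix is the Fisher information matrix $I(\theta)=E_{p_\theta}[\nabla_\theta\log p_\theta\,(\nabla_\theta\log p_\theta)^\top]$, and the Fisher-Rao distance $\rho(\theta_0,\theta_1)$ is the associated Riemannian distance, i.e. the infimum of $\int_0^1\sqrt{\dot c(t)^\top I(c(t))\,\dot c(t)}\,dt$ over piecewise smooth curves $c:[0,1]\to\Theta$ joining $\theta_0$ to $\theta_1$. *)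

theory Defs
  imports "HOL-Probability.Probability"
begin

text \<open>A statistical model is given by a base measure \<open>M\<close> and a family of densities \<open>p\<close>,
  \<open>p \<theta> x\<close> being the density of the distribution with parameter \<open>\<theta>\<close>. Coordinates on the parameter
  space are taken with respect to \<^const>\<open>Basis\<close>.\<close>

definition score :: "('a::euclidean_space \<Rightarrow> 'x \<Rightarrow> real) \<Rightarrow> 'a \<Rightarrow> 'x \<Rightarrow> 'a" where
  "score p \<theta> x =
     (\<Sum>i\<in>Basis. frechet_derivative (\<lambda>\<eta>. ln (p \<eta> x)) (at \<theta>) i *\<^sub>R i)"

definition fisher_matrix ::
    "'x measure \<Rightarrow> ('a::euclidean_space \<Rightarrow> 'x \<Rightarrow> real) \<Rightarrow> 'a \<Rightarrow> 'a \<Rightarrow> 'a \<Rightarrow> real" where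
  "fisher_matrix M p \<theta> i j =
     (\<integral>x. (score p \<theta> x \<bullet> i) * (score p \<theta> x \<bullet> j) \<partial>density M (\<lambda>x. ennreal (p \<theta> x)))"

definition fisher_norm ::
    "'x measure \<Rightarrow> ('a::euclidean_space \<Rightarrow> 'x \<Rightarrow> real) \<Rightarrow> 'a \<Rightarrow> 'a \<Rightarrow> real" where
  "fisher_norm M p \<theta> v =
     sqrt (\<Sum>i\<in>Basis. \<Sum>j\<in>Basis. (v \<bullet> i) * fisher_matrix M p \<theta> i j * (v \<bullet> j))"

text \<open>\<open>C\<^sup>\<infinity>\<close> on a closed interval, with one-sided derivatives at the end points; \<open>D n\<close> is the
  \<open>n\<close>-th derivative.\<close>

definition smooth_on_interval :: "(real \<Rightarrow> 'a::real_normed_vector) \<Rightarrow> real \<Rightarrow> real \<Rightarrow> bool" where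
  "smooth_on_interval c a b \<longleftrightarrow>
     (\<exists>D. D 0 = c \<and>
        (\<forall>n. \<forall>t\<in>{a..b}. (D n has_vector_derivative D (Suc n) t) (at t within {a..b})))"

text \<open>The library's \<^const>\<open>piecewise_C1_differentiable_on\<close> is not used here: it puts no condition on
  the derivative near the break points, so that it admits curves of infinite length, to which
  \<^const>\<open>integral\<close> would assign length \<open>0\<close>. Below, each piece is smooth up to and including its end
  points; continuity of \<open>c\<close> on \<open>{0..1}\<close> follows because adjacent closed pieces share a point.\<close>

definition piecewise_smooth_curve :: "(real \<Rightarrow> 'a::real_normed_vector) \<Rightarrow> bool" where
  "piecewise_smooth_curve c \<longleftrightarrow>
     (\<exists>n s. s 0 = 0 \<and> s n = 1 \<and>
        (\<forall>i<n. s i < s (Suc i) \<and> smooth_on_interval c (s i) (s (Suc i))))"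

text \<open>The derivative is unspecified at the finitely many break points, which do not contribute to
  the integral.\<close>

definition fisher_rao_length ::
    "'x measure \<Rightarrow> ('a::euclidean_space \<Rightarrow> 'x \<Rightarrow> real) \<Rightarrow> (real \<Rightarrow> 'a) \<Rightarrow> real" where
  "fisher_rao_length M p c =
     integral {0..1} (\<lambda>t. fisher_norm M p (c t) (vector_derivative c (at t within {0..1})))"

definition fisher_rao_dist ::
    "'x measure \<Rightarrow> ('a::euclidean_space \<Rightarrow> 'x \<Rightarrow> real) \<Rightarrow> 'a set \<Rightarrow> 'a \<Rightarrow> 'a \<Rightarrow> real" where
  "fisher_rao_dist M p \<Theta> \<theta>0 \<theta>1 =
     Inf {fisher_rao_length M p c |c.
            piecewise_smooth_curve c \<and> c ` {0..1} \<subseteq> \<Theta> \<and> c 0 = \<theta>0 \<and> c 1 = \<theta>1}"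

definition exp_family_density :: "('x \<Rightarrow> real) \<Rightarrow> (real \<Rightarrow> real) \<Rightarrow> real \<Rightarrow> 'x \<Rightarrow> real" where
  "exp_family_density t F \<theta> x = exp (\<theta> * t x - F \<theta>)"

text \<open>Normalization of every density says exactly that \<open>F \<theta>\<close> is the logarithm of the integral of
  \<open>exp (\<theta> * t x)\<close>. The statistic is required to be non-constant up to null sets.\<close>

definition regular_exp_family ::
    "'x measure \<Rightarrow> ('x \<Rightarrow> real) \<Rightarrow> (real \<Rightarrow> real) \<Rightarrow> real set \<Rightarrow> bool" where
  "regular_exp_family M t F \<Theta> \<longleftrightarrow>
     open \<Theta> \<and> is_interval \<Theta> \<and> t \<in> borel_measurable M \<and>
     (\<nexists>k. AE x in M. t x = k) \<and>
     (\<forall>\<theta>\<in>\<Theta>. prob_space (density M (\<lambda>x. ennreal (exp_family_density t F \<theta> x))))"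

end

theory Submission imports Defs begin

text \<open>Differentiating under the integral sign shows that the cumulant function is smooth and that its
  second derivative is the variance of the sufficient statistic, that is, the Fisher information.
  Hence the speed of a curve \<open>c\<close> is \<open>\<bar>c'\<bar> * sqrt (F'' c) = \<bar>(h \<circ> c)'\<bar>\<close>: the map \<open>h\<close> is a local
  isometry onto the real line with its usual metric. So every curve is at least as long as the
  distance of the \<open>h\<close>-images of its end points, with equality for the segment, on which \<open>h\<close> is
  monotone.\<close>

section \<open>Exponential moments\<close>

text \<open>A single term of the exponential series with nonnegative terms is at most its
  sum.\<close>

lemma power_le_exp_mult:
  fixes x d :: real
  assumes "0 \<le> x" "0 < d"
  shows "x ^ m \<le> fact m / d ^ m * exp (d * x)"
proof -
  have "(d * x) ^ m / fact m \<le> exp (d * x)"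
  proof -
    have s: "(\<lambda>n. (d * x) ^ n /\<^sub>R fact n) sums exp (d * x)" by (rule exp_converges)
    have "(\<Sum>n\<in>{m}. (d * x) ^ n /\<^sub>R fact n) \<le> exp (d * x)"
      unfolding sums_unique[OF s]
      by (rule sum_le_suminf) (use s assms in \<open>auto intro: sums_summable\<close>)
    then show ?thesis by (simp add: divide_inverse mult.commute)
  qed
  then show ?thesis using assms by (simp add: field_simps power_mult_distrib)
qed

text \<open>Lagrange form of the Taylor remainder: the exponential at the intermediate point is
  bounded by \<open>exp \<bar>u\<bar>\<close>, and the factor 1/2 is dropped.\<close>

lemma abs_exp_minus_one_minus_le:
  fixes u :: real
  shows "\<bar>exp u - 1 - u\<bar> \<le> u\<^sup>2 * exp \<bar>u\<bar>"
proof -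
  obtain s where s: "\<bar>s\<bar> \<le> \<bar>u\<bar>" "exp u = (\<Sum>m<2. u ^ m / fact m) + exp s / fact 2 * u ^ 2"
    using Maclaurin_exp_le[of u 2] by blast
  then have "exp u - 1 - u = exp s / 2 * u\<^sup>2"
    by (simp add: numeral_2_eq_2)
  moreover have "exp s / 2 \<le> exp \<bar>u\<bar>" using s(1) exp_le_cancel_iff[of s "\<bar>u\<bar>"] exp_ge_zero[of s]
    by linarith
  then have "exp s / 2 * u\<^sup>2 \<le> exp \<bar>u\<bar> * u\<^sup>2" by (intro mult_right_mono) auto
  moreover have "0 \<le> exp s / 2 * u\<^sup>2" by simp
  ultimately show ?thesis by (simp only: abs_of_nonneg mult.commute)
qed

text \<open>Unnormalised moments; for \<open>k = 0\<close> this is the partition function. Leaving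
  out the normaliser makes differentiation in \<theta> simply raise \<open>k\<close> by one.\<close>

definition exp_moment :: "'x measure \<Rightarrow> ('x \<Rightarrow> real) \<Rightarrow> nat \<Rightarrow> real \<Rightarrow> real" where
  "exp_moment M t k \<theta> = (\<integral>x. t x ^ k * exp (\<theta> * t x) \<partial>M)"

text \<open>As \<open>U\<close> is open, \<theta> can move both ways, and two shifted exponentials
  dominate every power of \<open>t\<close>. The extra \<open>d * \<bar>t x\<bar>\<close> lets one
  function dominate all parameters within \<open>d\<close> of \<theta>, with the same
  \<open>d\<close> for every \<open>m\<close>.\<close>

lemma exp_moment_dominated:
  fixes t :: "'x \<Rightarrow> real"
  assumes [measurable]: "t \<in> borel_measurable M"
    and "open U" "\<theta> \<in> U" and int: "\<And>\<eta>. \<eta> \<in> U \<Longrightarrow> integrable M (\<lambda>x. exp (\<eta> * t x))"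
  obtains d where "0 < d" "\<And>m. integrable M (\<lambda>x. \<bar>t x\<bar> ^ m * exp (\<theta> * t x + d * \<bar>t x\<bar>))"
proof -
  obtain e where e: "0 < e" "cball \<theta> e \<subseteq> U"
    using \<open>open U\<close> \<open>\<theta> \<in> U\<close> open_contains_cball by blast
  \<comment> \<open>The room \<open>e\<close> is spent twice: one \<open>d\<close> absorbs the
    power, the other stays in the exponent.\<close>
  define d where "d = e / 2"
  have d: "0 < d" and U: "\<theta> + 2 * d \<in> U" "\<theta> - 2 * d \<in> U"
    using e by (auto simp: d_def dist_real_def subset_iff)
  have "integrable M (\<lambda>x. \<bar>t x\<bar> ^ m * exp (\<theta> * t x + d * \<bar>t x\<bar>))" for m
  proof (rule Bochner_Integration.integrable_bound)
    show "integrable M (\<lambda>x. fact m / d ^ m * (exp ((\<theta> + 2 * d) * t x) + exp ((\<theta> - 2 * d) * t x)))"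
      using int[OF U(1)] int[OF U(2)] by auto
    show "AE x in M. norm (\<bar>t x\<bar> ^ m * exp (\<theta> * t x + d * \<bar>t x\<bar>)) \<le>
        norm (fact m / d ^ m * (exp ((\<theta> + 2 * d) * t x) + exp ((\<theta> - 2 * d) * t x)))"
    proof (rule AE_I2)
      fix x
      have "\<bar>t x\<bar> ^ m * exp (\<theta> * t x + d * \<bar>t x\<bar>)
          \<le> fact m / d ^ m * exp (d * \<bar>t x\<bar>) * exp (\<theta> * t x + d * \<bar>t x\<bar>)"
        using power_le_exp_mult[of "\<bar>t x\<bar>" d m] d by (intro mult_right_mono) auto
      also have "\<dots> = fact m / d ^ m * exp (\<theta> * t x + 2 * d * \<bar>t x\<bar>)"
        by (simp add: exp_add[symmetric] algebra_simps)
      \<comment> \<open>According to the sign of \<open>t x\<close>, the left exponential equals one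
        of the two on the right; the other is positive.\<close>
      also have "\<dots> \<le> fact m / d ^ m * (exp ((\<theta> + 2 * d) * t x) + exp ((\<theta> - 2 * d) * t x))"
        using d by (intro mult_left_mono, cases "t x \<ge> 0") (auto simp: algebra_simps)
      finally show "norm (\<bar>t x\<bar> ^ m * exp (\<theta> * t x + d * \<bar>t x\<bar>)) \<le>
          norm (fact m / d ^ m * (exp ((\<theta> + 2 * d) * t x) + exp ((\<theta> - 2 * d) * t x)))"
        using d by simp
    qed
  qed auto
  with d show thesis using that by blast
qed

lemma integrable_exp_moment:
  fixes t :: "'x \<Rightarrow> real"
  assumes [measurable]: "t \<in> borel_measurable M"
    and "open U" "\<theta> \<in> U" and "\<And>\<eta>. \<eta> \<in> U \<Longrightarrow> integrable M (\<lambda>x. exp (\<eta> * t x))"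
  shows "integrable M (\<lambda>x. t x ^ k * exp (\<theta> * t x))"
proof -
  obtain d where d: "0 < d" "\<And>m. integrable M (\<lambda>x. \<bar>t x\<bar> ^ m * exp (\<theta> * t x + d * \<bar>t x\<bar>))"
    using exp_moment_dominated[OF assms] by blast
  show ?thesis
    by (rule Bochner_Integration.integrable_bound[OF d(2)[of k]])
      (use d(1) in \<open>auto simp: abs_mult power_abs intro!: AE_I2 mult_left_mono\<close>)
qed

text \<open>Integrating the pointwise Taylor bound for \<open>exp\<close> gives a remainder of at
  most \<open>u\<^sup>2 * C\<close>, so the difference quotient converges at a linear rate and no
  limit is exchanged with the integral.\<close>

lemma exp_moment_has_derivative:
  fixes t :: "'x \<Rightarrow> real"
  assumes [measurable]: "t \<in> borel_measurable M"
    and "open U" "\<theta> \<in> U" and "\<And>\<eta>. \<eta> \<in> U \<Longrightarrow> integrable M (\<lambda>x. exp (\<eta> * t x))"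
  shows "(exp_moment M t k has_real_derivative exp_moment M t (Suc k) \<theta>) (at \<theta>)"
proof -
  obtain d where d: "0 < d" "\<And>m. integrable M (\<lambda>x. \<bar>t x\<bar> ^ m * exp (\<theta> * t x + d * \<bar>t x\<bar>))"
    using exp_moment_dominated[OF assms] by blast
  have int: "integrable M (\<lambda>x. t x ^ j * exp ((\<theta> + u) * t x))" if "\<bar>u\<bar> \<le> d" for u j
  proof (rule Bochner_Integration.integrable_bound[OF d(2)[of j]])
    have "u * t x \<le> d * \<bar>t x\<bar>" for x
      using mult_right_mono[OF that abs_ge_zero[of "t x"]] abs_ge_self[of "u * t x"]
      by (simp add: abs_mult)
    then show "AE x in M. norm (t x ^ j * exp ((\<theta> + u) * t x)) \<le>
        norm (\<bar>t x\<bar> ^ j * exp (\<theta> * t x + d * \<bar>t x\<bar>))"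
      by (auto simp: abs_mult power_abs algebra_simps intro!: AE_I2 mult_left_mono)
  qed auto
  \<comment> \<open>The two extra powers of \<open>\<bar>t x\<bar>\<close> come from the quadratic
    remainder in \<open>u * t x\<close>; \<open>C\<close> does not depend on
    \<open>u\<close>.\<close>
  define C where "C = (\<integral>x. \<bar>t x\<bar> ^ (k + 2) * exp (\<theta> * t x + d * \<bar>t x\<bar>) \<partial>M)"
  have bound: "\<bar>exp_moment M t k (\<theta> + u) - exp_moment M t k \<theta> - u * exp_moment M t (Suc k) \<theta>\<bar>
      \<le> u\<^sup>2 * C" if "\<bar>u\<bar> \<le> d" for u
  proof -
    have i0: "integrable M (\<lambda>x. t x ^ j * exp (\<theta> * t x))" for j
      using int[of 0 j] d(1) by simp
    have remainder: "exp_moment M t k (\<theta> + u) - exp_moment M t k \<theta>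
          - u * exp_moment M t (Suc k) \<theta> =
        (\<integral>x. t x ^ k * exp ((\<theta> + u) * t x) - t x ^ k * exp (\<theta> * t x)
           - u * (t x ^ Suc k * exp (\<theta> * t x)) \<partial>M)"
      unfolding exp_moment_def using int[OF that, of k] i0[of k] i0[of "Suc k"]
      by (simp del: power_Suc)
    have "\<bar>\<integral>x. t x ^ k * exp ((\<theta> + u) * t x) - t x ^ k * exp (\<theta> * t x)
           - u * (t x ^ Suc k * exp (\<theta> * t x)) \<partial>M\<bar> \<le>
        (\<integral>x. u\<^sup>2 * (\<bar>t x\<bar> ^ (k + 2) * exp (\<theta> * t x + d * \<bar>t x\<bar>)) \<partial>M)"
    proof (rule order_trans[OF integral_abs_bound integral_mono])
      show "integrable M (\<lambda>x. \<bar>t x ^ k * exp ((\<theta> + u) * t x) - t x ^ k * exp (\<theta> * t x)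
           - u * (t x ^ Suc k * exp (\<theta> * t x))\<bar>)"
        using int[OF that, of k] i0[of k] i0[of "Suc k"] by (simp del: power_Suc)
      show "integrable M (\<lambda>x. u\<^sup>2 * (\<bar>t x\<bar> ^ (k + 2) * exp (\<theta> * t x + d * \<bar>t x\<bar>)))"
        using d(2)[of "k + 2"] by (simp del: power_Suc)
      fix x
      have "t x ^ k * exp ((\<theta> + u) * t x) - t x ^ k * exp (\<theta> * t x)
           - u * (t x ^ Suc k * exp (\<theta> * t x)) =
          t x ^ k * exp (\<theta> * t x) * (exp (u * t x) - 1 - u * t x)"
        by (simp add: algebra_simps exp_add)
      also have "\<bar>\<dots>\<bar> \<le> \<bar>t x\<bar> ^ k * exp (\<theta> * t x) * ((u * t x)\<^sup>2 * exp \<bar>u * t x\<bar>)"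
        using abs_exp_minus_one_minus_le[of "u * t x"]
        by (subst abs_mult) (auto simp: abs_mult power_abs intro!: mult_left_mono)
      also have "\<dots> \<le> \<bar>t x\<bar> ^ k * exp (\<theta> * t x) * ((u * t x)\<^sup>2 * exp (d * \<bar>t x\<bar>))"
        using that by (intro mult_left_mono) (auto simp: abs_mult intro!: mult_right_mono)
      also have "\<dots> = u\<^sup>2 * (\<bar>t x\<bar> ^ (k + 2) * exp (\<theta> * t x + d * \<bar>t x\<bar>))"
        by (simp add: power_mult_distrib exp_add power_add power2_eq_square)
      finally show "\<bar>t x ^ k * exp ((\<theta> + u) * t x) - t x ^ k * exp (\<theta> * t x)
           - u * (t x ^ Suc k * exp (\<theta> * t x))\<bar> \<le>
          u\<^sup>2 * (\<bar>t x\<bar> ^ (k + 2) * exp (\<theta> * t x + d * \<bar>t x\<bar>))" .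
    qed
    also have "\<dots> = u\<^sup>2 * C" by (simp add: C_def)
    finally show ?thesis unfolding remainder .
  qed
  let ?q = "\<lambda>u. (exp_moment M t k (\<theta> + u) - exp_moment M t k \<theta>) / u"
  have "((\<lambda>u. ?q u - exp_moment M t (Suc k) \<theta>) \<longlongrightarrow> 0) (at 0)"
  proof (rule Lim_null_comparison)
    show "\<forall>\<^sub>F u in at 0. norm (?q u - exp_moment M t (Suc k) \<theta>) \<le> \<bar>u\<bar> * C"
      unfolding eventually_at
    proof (intro exI[of _ d] conjI ballI impI)
      fix u :: real assume u: "u \<noteq> 0 \<and> dist u 0 < d"
      have "?q u - exp_moment M t (Suc k) \<theta> =
          (exp_moment M t k (\<theta> + u) - exp_moment M t k \<theta> - u * exp_moment M t (Suc k) \<theta>) / u"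
        using u by (simp add: diff_divide_distrib)
      also have "norm \<dots> \<le> u\<^sup>2 * C / \<bar>u\<bar>"
        using bound[of u] u by (simp add: divide_right_mono)
      also have "\<dots> = \<bar>u\<bar> * C"
      proof -
        have "u\<^sup>2 = \<bar>u\<bar> * \<bar>u\<bar>" by (simp add: power2_eq_square)
        then show ?thesis using u by (simp del: abs_mult_self_eq)
      qed
      finally show "norm (?q u - exp_moment M t (Suc k) \<theta>) \<le> \<bar>u\<bar> * C" .
    qed (use d in auto)
    show "((\<lambda>u. \<bar>u\<bar> * C) \<longlongrightarrow> 0) (at (0::real))"
      by (auto intro!: tendsto_eq_intros)
  qed
  then show ?thesis unfolding DERIV_def by (simp add: LIM_zero_iff)
qed

section \<open>The Fisher information\<close>

locale exp_family =
  fixes M :: "'x measure" and t :: "'x \<Rightarrow> real" and F :: "real \<Rightarrow> real" and \<Theta> :: "real set"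
  assumes regular: "regular_exp_family M t F \<Theta>"
begin

lemma open_param: "open \<Theta>"
  and interval_param: "is_interval \<Theta>"
  and statistic_measurable [measurable]: "t \<in> borel_measurable M"
  using regular by (auto simp: regular_exp_family_def)

text \<open>The normalised density has mass one; multiplying by \<open>exp (F \<theta>)\<close>
  removes the normaliser and yields both claims.\<close>

lemma integrable_exp_statistic:
  assumes "\<theta> \<in> \<Theta>"
  shows "integrable M (\<lambda>x. exp (\<theta> * t x))" and "exp_moment M t 0 \<theta> = exp (F \<theta>)"
proof -
  interpret prob_space "density M (\<lambda>x. ennreal (exp_family_density t F \<theta> x))"
    using regular assms by (simp add: regular_exp_family_def)
  have "(\<integral>\<^sup>+ x. ennreal (exp (\<theta> * t x - F \<theta>)) \<partial>M) = 1"
    using emeasure_space_1 by (simp add: emeasure_density exp_family_density_def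
        cong: nn_integral_cong)
  then have "has_bochner_integral M (\<lambda>x. exp (\<theta> * t x - F \<theta>)) 1"
    by (intro has_bochner_integral_nn_integral) auto
  then have *: "has_bochner_integral M (\<lambda>x. exp (F \<theta>) * exp (\<theta> * t x - F \<theta>)) (exp (F \<theta>) * 1)"
    by (intro has_bochner_integral_mult_right)
  have "has_bochner_integral M (\<lambda>x. exp (\<theta> * t x)) (exp (F \<theta>))"
    using * by (simp add: exp_add[symmetric])
  then show "integrable M (\<lambda>x. exp (\<theta> * t x))" and "exp_moment M t 0 \<theta> = exp (F \<theta>)"
    by (auto simp: has_bochner_integral_iff exp_moment_def)
qed

section \<open>Derivatives of the cumulant function\<close>

lemmas moment_derivative =
  exp_moment_has_derivative[OF statistic_measurable open_param _ integrable_exp_statistic(1)]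

lemma moment_0_pos: "\<theta> \<in> \<Theta> \<Longrightarrow> exp_moment M t 0 \<theta> > 0"
  by (simp add: integrable_exp_statistic)

text \<open>On \<Theta> the function \<open>F\<close> is the logarithm of the partition function,
  and since \<Theta> is open the derivative carries over.\<close>

lemma cumulant_derivative:
  assumes "\<theta> \<in> \<Theta>"
  shows "(F has_real_derivative exp_moment M t 1 \<theta> / exp_moment M t 0 \<theta>) (at \<theta>)"
proof (rule has_field_derivative_transform_within_open[OF _ open_param assms])
  show "((\<lambda>\<theta>. ln (exp_moment M t 0 \<theta>)) has_real_derivative
      exp_moment M t 1 \<theta> / exp_moment M t 0 \<theta>) (at \<theta>)"
    using moment_derivative[OF assms, of 0] moment_0_pos[OF assms]
    by (auto intro!: derivative_eq_intros)
qed (simp add: integrable_exp_statistic)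

lemma deriv_cumulant:
  "\<theta> \<in> \<Theta> \<Longrightarrow> deriv F \<theta> = exp_moment M t 1 \<theta> / exp_moment M t 0 \<theta>"
  using cumulant_derivative by (rule DERIV_imp_deriv)

text \<open>By the quotient rule; the right-hand side is the second moment minus the squared mean of
  \<open>t\<close>, hence its variance.\<close>

lemma deriv2_cumulant:
  assumes "\<theta> \<in> \<Theta>"
  shows "deriv (deriv F) \<theta> = exp_moment M t 2 \<theta> / exp_moment M t 0 \<theta> - (deriv F \<theta>)\<^sup>2"
proof (rule DERIV_imp_deriv, rule has_field_derivative_transform_within_open[OF _ open_param assms])
  show "((\<lambda>\<theta>. exp_moment M t 1 \<theta> / exp_moment M t 0 \<theta>) has_real_derivative
      exp_moment M t 2 \<theta> / exp_moment M t 0 \<theta> - (deriv F \<theta>)\<^sup>2) (at \<theta>)"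
    using moment_derivative[OF assms, of 0] moment_derivative[OF assms, of 1] moment_0_pos[OF assms]
    by (auto intro!: derivative_eq_intros
        simp: numeral_2_eq_2 deriv_cumulant assms field_simps power2_eq_square)
qed (simp add: deriv_cumulant)

text \<open>Needed for the integrability of the speed along a curve.\<close>

lemma continuous_on_deriv2_cumulant: "continuous_on \<Theta> (deriv (deriv F))"
proof -
  have m: "continuous_on \<Theta> (exp_moment M t k)" for k
    by (rule continuous_at_imp_continuous_on) (auto intro: DERIV_isCont moment_derivative)
  have "continuous_on \<Theta> (\<lambda>\<theta>. exp_moment M t 2 \<theta> / exp_moment M t 0 \<theta> -
      (exp_moment M t 1 \<theta> / exp_moment M t 0 \<theta>)\<^sup>2)"
    using moment_0_pos by (intro continuous_intros m) force+
  then show ?thesis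
    by (rule continuous_on_eq) (simp add: deriv2_cumulant deriv_cumulant)
qed

section \<open>Score and Fisher information\<close>

lemma score_exp_family:
  assumes "\<theta> \<in> \<Theta>"
  shows "score (exp_family_density t F) \<theta> x = t x - deriv F \<theta>"
proof -
  have "((\<lambda>\<eta>. \<eta> * t x - F \<eta>) has_real_derivative t x - deriv F \<theta>) (at \<theta>)"
    using cumulant_derivative[OF assms]
    by (auto intro!: derivative_eq_intros simp: deriv_cumulant assms)
  then have "frechet_derivative (\<lambda>\<eta>. \<eta> * t x - F \<eta>) (at \<theta>) = (*) (t x - deriv F \<theta>)"
    unfolding has_field_derivative_def by (rule frechet_derivative_at[symmetric])
  then show ?thesis by (simp add: score_def exp_family_density_def)
qed

lemma fisher_matrix_exp_family:
  assumes "\<theta> \<in> \<Theta>"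
  shows "fisher_matrix M (exp_family_density t F) \<theta> 1 1 = deriv (deriv F) \<theta>"
proof -
  note int = integrable_exp_moment[OF statistic_measurable open_param assms integrable_exp_statistic(1)]
  let ?m = "deriv F \<theta>" and ?Z = "exp_moment M t 0 \<theta>"
  have Z: "?Z > 0" "exp (F \<theta>) = ?Z"
    using moment_0_pos integrable_exp_statistic assms by auto
  have [measurable]: "exp_family_density t F \<theta> \<in> borel_measurable M"
    unfolding exp_family_density_def by measurable
  have "fisher_matrix M (exp_family_density t F) \<theta> 1 1 =
      (\<integral>x. exp_family_density t F \<theta> x * ((t x - ?m) * (t x - ?m)) \<partial>M)"
    unfolding fisher_matrix_def score_exp_family[OF assms]
    by (subst integral_density) (auto simp: exp_family_density_def)
  \<comment> \<open>The square is expanded into three moments. The exponents 1 and 0 stay written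
    out so that the terms match \<open>exp_moment\<close>.\<close>
  also have "\<dots> = (\<integral>x. (t x ^ 2 * exp (\<theta> * t x) - 2 * ?m * (t x ^ 1 * exp (\<theta> * t x)) +
      ?m\<^sup>2 * (t x ^ 0 * exp (\<theta> * t x))) / ?Z \<partial>M)"
    using Z by (intro Bochner_Integration.integral_cong)
      (auto simp: exp_family_density_def exp_diff field_simps power2_eq_square)
  also have "\<dots> = (exp_moment M t 2 \<theta> - 2 * ?m * exp_moment M t 1 \<theta> + ?m\<^sup>2 * ?Z) / ?Z"
    unfolding exp_moment_def using int[of 2] int[of 1] int[of 0]
    by (simp del: power_0 power_one_right)
  also have "\<dots> = deriv (deriv F) \<theta>"
    using Z by (simp add: deriv2_cumulant assms deriv_cumulant field_simps power2_eq_square)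
  finally show ?thesis .
qed

lemma fisher_norm_exp_family:
  "\<theta> \<in> \<Theta> \<Longrightarrow>
    fisher_norm M (exp_family_density t F) \<theta> v = \<bar>v\<bar> * sqrt (deriv (deriv F) \<theta>)"
  by (simp add: fisher_norm_def fisher_matrix_exp_family real_sqrt_mult)

text \<open>The Fisher information is the integral of a square. The sign matters because
  \<open>sqrt\<close> is an odd function on the reals, negative at negative arguments.\<close>

lemma deriv2_cumulant_nonneg: "\<theta> \<in> \<Theta> \<Longrightarrow> 0 \<le> deriv (deriv F) \<theta>"
  by (subst fisher_matrix_exp_family[symmetric]) (auto simp: fisher_matrix_def)

end

section \<open>Lengths of curves\<close>

lemma smooth_on_interval_affine:
  fixes a b :: "'a::real_normed_vector"
  shows "smooth_on_interval (\<lambda>s. a + s *\<^sub>R b) u v"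
  unfolding smooth_on_interval_def
\<comment> \<open>The sequence of derivatives: the map itself, the constant \<open>b\<close>, then
  zero.\<close>
proof (intro exI[of _ "\<lambda>n. if n = 0 then (\<lambda>s. a + s *\<^sub>R b) else if n = 1 then (\<lambda>s. b) else (\<lambda>s. 0)"]
    conjI allI ballI)
  fix n and s :: real
  show "((if n = 0 then \<lambda>s. a + s *\<^sub>R b else if n = 1 then \<lambda>s. b else (\<lambda>s. 0)) has_vector_derivative
      (if Suc n = 0 then \<lambda>s. a + s *\<^sub>R b else if Suc n = 1 then \<lambda>s. b else (\<lambda>s. 0)) s)
      (at s within {u..v})"
    by (auto intro!: derivative_eq_intros)
qed simp

lemma piecewise_smooth_curve_affine:
  fixes a b :: "'a::real_normed_vector"
  shows "piecewise_smooth_curve (\<lambda>s. a + s *\<^sub>R b)"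
  unfolding piecewise_smooth_curve_def
  \<comment> \<open>One piece, with the embedding \<open>real\<close> giving the break points 0 and
    1.\<close>
  by (intro exI[of _ "1::nat"] exI[of _ real]) (auto simp: smooth_on_interval_affine)

section \<open>Lower bound for the length of a curve\<close>

context exp_family
begin

context
  fixes h :: "real \<Rightarrow> real"
  assumes antiderivative:
    "\<And>\<theta>. \<theta> \<in> \<Theta> \<Longrightarrow> (h has_real_derivative sqrt (deriv (deriv F) \<theta>)) (at \<theta>)"
begin

text \<open>Inside a smooth piece the speed is the absolute value of the derivative of
  \<open>h \<circ> c\<close>, so the bound is the fundamental theorem followed by the triangle
  inequality for integrals. Integrability is stated too because gluing the pieces requires
  it.\<close>

lemma piece_length_ge:
  assumes smooth: "smooth_on_interval c a b" and ab: "0 \<le> a" "a < b" "b \<le> 1"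
    and c: "c ` {0..1} \<subseteq> \<Theta>"
  defines "f \<equiv> \<lambda>s. fisher_norm M (exp_family_density t F) (c s) (vector_derivative c (at s within {0..1}))"
  shows "f integrable_on {a..b}" and "\<bar>h (c b) - h (c a)\<bar> \<le> integral {a..b} f"
proof -
  obtain D where D0: "D 0 = c" and
    "\<forall>n. \<forall>s\<in>{a..b}. (D n has_vector_derivative D (Suc n) s) (at s within {a..b})"
    using smooth unfolding smooth_on_interval_def by (elim exE conjE) (rule that)
  then have D: "(D n has_vector_derivative D (Suc n) s) (at s within {a..b})" if "s \<in> {a..b}" for n s
    using that by simp
  have cD: "(c has_real_derivative D 1 s) (at s within {a..b})" if "s \<in> {a..b}" for s
    using D[OF that, of 0] by (simp add: D0 has_real_derivative_iff_has_vector_derivative)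
  have c\<Theta>: "c s \<in> \<Theta>" if "s \<in> {a..b}" for s
    using that ab c by force
  define g where "g s = D 1 s * sqrt (deriv (deriv F) (c s))" for s
  have "continuous_on {a..b} (D n)" for n
    by (rule continuous_on_vector_derivative) (rule D)
  from this[of 0] this[of 1] have cont_c: "continuous_on {a..b} c" and "continuous_on {a..b} (D 1)"
    by (simp_all add: D0)
  moreover have "continuous_on {a..b} (\<lambda>s. deriv (deriv F) (c s))"
    using c\<Theta> by (intro continuous_on_compose2[OF continuous_on_deriv2_cumulant cont_c]) auto
  ultimately have "continuous_on {a..b} (\<lambda>s. \<bar>g s\<bar>)"
    unfolding g_def by (intro continuous_intros)
  then have g_int: "(\<lambda>s. \<bar>g s\<bar>) integrable_on {a..b}"
    by (rule integrable_continuous_real)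
  \<comment> \<open>At \<open>a\<close> and \<open>b\<close> the curve may have a corner, where
    \<open>vector_derivative\<close> is unspecified; these two points are negligible for the
    integral.\<close>
  have eq: "f s = \<bar>g s\<bar>" if "s \<in> {a..b} - {a, b}" for s
  proof -
    have s: "a < s" "s < b" "s \<in> {a..b}" using that by auto
    have "(c has_vector_derivative D 1 s) (at s)"
      using D[OF s(3), of 0] s at_within_Icc_at[OF s(1,2)] by (simp add: D0)
    moreover have "at s within {0..1} = at s"
      using s ab by (intro at_within_Icc_at) auto
    ultimately have "vector_derivative c (at s within {0..1}) = D 1 s"
      by (simp add: vector_derivative_at)
    then show ?thesis
      using fisher_norm_exp_family[OF c\<Theta>[OF s(3)]] deriv2_cumulant_nonneg[OF c\<Theta>[OF s(3)]]
      by (simp add: f_def g_def abs_mult)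
  qed
  show "f integrable_on {a..b}"
    by (rule integrable_spike_finite[OF _ _ g_int, of "{a, b}"]) (use eq in auto)
  have f_g: "integral {a..b} f = integral {a..b} (\<lambda>s. \<bar>g s\<bar>)"
    by (rule integral_spike[of "{a, b}"]) (use eq in auto)
  have "(g has_integral h (c b) - h (c a)) {a..b}"
  proof (rule fundamental_theorem_of_calculus)
    fix s assume s: "s \<in> {a..b}"
    show "((\<lambda>s. h (c s)) has_vector_derivative g s) (at s within {a..b})"
      using DERIV_chain2[OF antiderivative[OF c\<Theta>[OF s]] cD[OF s]]
      by (simp add: g_def mult.commute has_real_derivative_iff_has_vector_derivative)
  qed (use ab in auto)
  then show "\<bar>h (c b) - h (c a)\<bar> \<le> integral {a..b} f"
    using integral_norm_bound_integral[of g "{a..b}" "\<lambda>s. \<bar>g s\<bar>"] g_int f_g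
    by (auto simp: has_integral_iff)
qed

text \<open>The bounds for the pieces are added up, and the triangle inequality for \<open>h\<close>
  at successive break points gives the bound for the whole curve.\<close>

lemma fisher_rao_length_ge:
  assumes "piecewise_smooth_curve c" and c: "c ` {0..1} \<subseteq> \<Theta>"
  shows "\<bar>h (c 1) - h (c 0)\<bar> \<le> fisher_rao_length M (exp_family_density t F) c"
proof -
  obtain n s where s: "s 0 = 0" "s n = 1"
    and "\<forall>i<n. s i < s (Suc i) \<and> smooth_on_interval c (s i) (s (Suc i))"
    using assms(1) unfolding piecewise_smooth_curve_def by (elim exE conjE) (rule that)
  then have pieces: "s i < s (Suc i)" "smooth_on_interval c (s i) (s (Suc i))" if "i < n" for i
    using that by auto
  \<comment> \<open>This places all break points in the unit interval, as
    \<open>piece_length_ge\<close> demands.\<close>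
  have mono: "s i \<le> s j" if "i \<le> j" "j \<le> n" for i j
    using that
  proof (induction j rule: dec_induct)
    case (step j)
    then show ?case using pieces(1)[of j] by simp
  qed simp
  define f where
    "f = (\<lambda>s. fisher_norm M (exp_family_density t F) (c s) (vector_derivative c (at s within {0..1})))"
  have "f integrable_on {0..s k} \<and> \<bar>h (c (s k)) - h (c 0)\<bar> \<le> integral {0..s k} f" if "k \<le> n" for k
    using that
  proof (induction k)
    case 0
    show ?case using integrable_on_refl[of f 0] by (simp add: s)
  next
    case (Suc k)
    then have IH: "f integrable_on {0..s k}" "\<bar>h (c (s k)) - h (c 0)\<bar> \<le> integral {0..s k} f"
      by auto
    have k: "k < n" "0 \<le> s k" "s (Suc k) \<le> 1" "s k < s (Suc k)"
      using Suc.prems mono[of 0 k] mono[of "Suc k" n] pieces(1)[of k] s by auto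
    note piece = piece_length_ge[OF pieces(2)[OF k(1)] k(2,4,3) c, folded f_def]
    have int: "f integrable_on {0..s (Suc k)}"
      by (rule Henstock_Kurzweil_Integration.integrable_combine[of 0 "s k"])
        (use k IH(1) piece(1) in auto)
    moreover have "integral {0..s k} f + integral {s k..s (Suc k)} f = integral {0..s (Suc k)} f"
      by (rule Henstock_Kurzweil_Integration.integral_combine) (use k int in auto)
    ultimately show ?case using IH(2) piece(2) by linarith
  qed
  from this[of n] show ?thesis by (simp add: s fisher_rao_length_def f_def)
qed

section \<open>The segment attains the bound\<close>

lemma segment_subset_param:
  assumes "\<theta>0 \<in> \<Theta>" "\<theta>1 \<in> \<Theta>" "s \<in> {0..1}"
  shows "\<theta>0 + s *\<^sub>R (\<theta>1 - \<theta>0) \<in> \<Theta>"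
proof -
  have "(1 - s) *\<^sub>R \<theta>0 + s *\<^sub>R \<theta>1 \<in> \<Theta>"
    using assms is_interval_convex[OF interval_param] by (intro convexD) auto
  then show ?thesis by (simp add: algebra_simps)
qed

text \<open>Along the segment the derivative of \<open>h\<close> keeps the sign of
  \<open>\<theta>1 - \<theta>0\<close>, so nothing is lost in passing to absolute values.\<close>

lemma fisher_rao_length_segment:
  assumes "\<theta>0 \<in> \<Theta>" "\<theta>1 \<in> \<Theta>"
  shows "fisher_rao_length M (exp_family_density t F) (\<lambda>s. \<theta>0 + s *\<^sub>R (\<theta>1 - \<theta>0)) =
    \<bar>h \<theta>1 - h \<theta>0\<bar>"
proof -
  let ?c = "\<lambda>s. \<theta>0 + s *\<^sub>R (\<theta>1 - \<theta>0)"
  let ?r = "\<lambda>s. sqrt (deriv (deriv F) (?c s))"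
  have D: "((\<lambda>s. h (?c s)) has_vector_derivative (\<theta>1 - \<theta>0) * ?r s) (at s within {0..1})"
    if "s \<in> {0..1}" for s
  proof -
    have "(?c has_real_derivative \<theta>1 - \<theta>0) (at s within {0..1})"
      by (auto intro!: derivative_eq_intros)
    from DERIV_chain2[OF antiderivative[OF segment_subset_param[OF assms that]] this]
    show ?thesis by (simp add: mult.commute has_real_derivative_iff_has_vector_derivative)
  qed
  have "((\<lambda>s. (\<theta>1 - \<theta>0) * ?r s) has_integral h (?c 1) - h (?c 0)) {0..1}"
    by (rule fundamental_theorem_of_calculus) (use D in auto)
  \<comment> \<open>Multiplying by the sign turns the derivative into the speed without a case
    distinction.\<close>
  then have "((\<lambda>s. sgn (\<theta>1 - \<theta>0) * ((\<theta>1 - \<theta>0) * ?r s)) has_integral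
      sgn (\<theta>1 - \<theta>0) * (h \<theta>1 - h \<theta>0)) {0..1}"
    by (intro has_integral_mult_right) simp
  then have I: "((\<lambda>s. \<bar>\<theta>1 - \<theta>0\<bar> * ?r s) has_integral sgn (\<theta>1 - \<theta>0) * (h \<theta>1 - h \<theta>0)) {0..1}"
    by (simp add: mult.assoc[symmetric] abs_sgn mult.commute)
  have "vector_derivative ?c (at s within {0..1}) = \<theta>1 - \<theta>0" if "s \<in> {0..1}" for s
    by (rule vector_derivative_within_closed_interval)
      (use that in \<open>auto intro!: derivative_eq_intros\<close>)
  \<comment> \<open>Removing \<open>real_scaleR_def\<close> keeps the points of the segment in the
    form in which \<open>segment_subset_param\<close> applies.\<close>
  then have "fisher_rao_length M (exp_family_density t F) ?c = integral {0..1} (\<lambda>s. \<bar>\<theta>1 - \<theta>0\<bar> * ?r s)"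
    unfolding fisher_rao_length_def
    by (intro integral_cong)
      (simp add: fisher_norm_exp_family segment_subset_param[OF assms] del: real_scaleR_def)
  also have "\<dots> = sgn (\<theta>1 - \<theta>0) * (h \<theta>1 - h \<theta>0)"
    using I by (rule integral_unique)
  also have "\<dots> = \<bar>h \<theta>1 - h \<theta>0\<bar>"
  proof -
    \<comment> \<open>As the integral of a nonnegative speed, the product is nonnegative, so it
      equals the absolute value of the difference of \<open>h\<close>; for equal end points both are
      zero.\<close>
    have "0 \<le> sgn (\<theta>1 - \<theta>0) * (h \<theta>1 - h \<theta>0)"
      by (rule has_integral_nonneg[OF I])
        (simp add: deriv2_cumulant_nonneg segment_subset_param[OF assms] del: real_scaleR_def)
    then show ?thesis
      by (cases \<theta>0 \<theta>1 rule: linorder_cases) (auto simp: sgn_if)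
  qed
  finally show ?thesis .
qed

text \<open>The segment makes the infimum a minimum, so membership and the lower bound
  suffice.\<close>

lemma fisher_rao_dist_exp_family:
  assumes "\<theta>0 \<in> \<Theta>" "\<theta>1 \<in> \<Theta>"
  shows "fisher_rao_dist M (exp_family_density t F) \<Theta> \<theta>0 \<theta>1 = \<bar>h \<theta>1 - h \<theta>0\<bar>"
  unfolding fisher_rao_dist_def
proof (rule cInf_eq_minimum)
  show "\<bar>h \<theta>1 - h \<theta>0\<bar> \<in> {fisher_rao_length M (exp_family_density t F) c |c.
      piecewise_smooth_curve c \<and> c ` {0..1} \<subseteq> \<Theta> \<and> c 0 = \<theta>0 \<and> c 1 = \<theta>1}"
    using fisher_rao_length_segment[OF assms, symmetric] segment_subset_param[OF assms]
      piecewise_smooth_curve_affine[of \<theta>0 "\<theta>1 - \<theta>0"]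
    by (intro CollectI exI[of _ "\<lambda>s. \<theta>0 + s *\<^sub>R (\<theta>1 - \<theta>0)"]) auto
qed (use fisher_rao_length_ge in auto)

end

end

theorem proposition2:
  fixes M :: "'x measure" and t :: "'x \<Rightarrow> real" and F h :: "real \<Rightarrow> real"
    and \<Theta> :: "real set" and \<theta>0 \<theta>1 :: real
  assumes "regular_exp_family M t F \<Theta>"
    and "\<And>\<theta>. \<theta> \<in> \<Theta> \<Longrightarrow> (h has_real_derivative sqrt (deriv (deriv F) \<theta>)) (at \<theta>)"
    and "\<theta>0 \<in> \<Theta>" and "\<theta>1 \<in> \<Theta>"
  shows "fisher_rao_dist M (exp_family_density t F) \<Theta> \<theta>0 \<theta>1 = \<bar>h \<theta>1 - h \<theta>0\<bar>"
proof -
  interpret exp_family M t F \<Theta>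
    using assms(1) by (rule exp_family.intro)
  show ?thesis
    using assms(2-4) by (rule fisher_rao_dist_exp_family)
qed

end
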